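(* Let $G$ be the graph consisting of a triangle on vertices $a,b,c$ together with four pendant vertices (degree-one vertices) attached to each of $a$, $b$ and $c$ (so $a,b,c$ have degree $6$). Consider the planar embedding of $G$ in which the four pendant edges at $a$ and the four pendant edges at $b$ lie outside the triangle, while the four pendant edges at $c$ lie inside the triangle. Then $G$ has no planar Lombardi drawing for this embedding.
   Context: A Lombardi drawing maps each vertex to a point and each edge to a circular arc or line segment joining the points of its endpoints, such that at each vertex $v$ the incident arcs are equally spaced around $v$, consecutive arcs forming angles $2\pi/\deg(v)$. It is planar if the only intersection points of its arcs are shared endpoints; a Lombardi drawing for a given embedding is one whose rotation of arcs around each vertex and whose faces agree with that embedding. *)

theory Defs
  imports "HOL-Analysis.Analysis"
begin

text \<open>A graph is given by a vertex set V and a set E of edges, each edge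
  being an ordered pair (u,v) with u and v distinct (orientation only fixes
  a parametrisation direction of the curve drawn for the edge).
  A drawing is a pair (pos, crv): pos maps vertices to points of the plane
  (complex numbers), crv maps each edge to a path on [0,1].\<close>

definition circ_arc :: "(real \<Rightarrow> complex) \<Rightarrow> bool" where
  "circ_arc g \<longleftrightarrow>
     (\<exists>p q. p \<noteq> q \<and> g = linepath p q) \<or>
     (\<exists>z r th d. r > 0 \<and> d \<noteq> 0 \<and> \<bar>d\<bar> < 2 * pi \<and>
        g = (\<lambda>t. z + rcis r (th + t * d)))"

definition incident :: "('v \<times> 'v) set \<Rightarrow> 'v \<Rightarrow> ('v \<times> 'v) set" where
  "incident E v = {e \<in> E. fst e = v \<or> snd e = v}"

definition degree :: "('v \<times> 'v) set \<Rightarrow> 'v \<Rightarrow> nat" where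
  "degree E v = card (incident E v)"

definition out_dir :: "(('v \<times> 'v) \<Rightarrow> real \<Rightarrow> complex) \<Rightarrow> 'v \<Rightarrow> ('v \<times> 'v) \<Rightarrow> complex" where
  "out_dir crv v e =
     (if fst e = v then sgn (vector_derivative (crv e) (at 0 within {0..1}))
      else sgn (- vector_derivative (crv e) (at 1 within {0..1})))"

definition lombardi_drawing ::
  "'v set \<Rightarrow> ('v \<times> 'v) set \<Rightarrow> ('v \<Rightarrow> complex) \<Rightarrow> (('v \<times> 'v) \<Rightarrow> real \<Rightarrow> complex) \<Rightarrow> bool" where
  "lombardi_drawing V E pos crv \<longleftrightarrow>
     inj_on pos V \<and>
     (\<forall>e\<in>E. circ_arc (crv e) \<and> pathstart (crv e) = pos (fst e) \<and>
              pathfinish (crv e) = pos (snd e)) \<and>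
     (\<forall>v\<in>V. \<exists>w. norm w = 1 \<and>
        bij_betw (out_dir crv v) (incident E v)
          {w * cis (2 * pi * real k / real (degree E v)) | k. k < degree E v})"

definition planar_drawing ::
  "('v \<times> 'v) set \<Rightarrow> ('v \<Rightarrow> complex) \<Rightarrow> (('v \<times> 'v) \<Rightarrow> real \<Rightarrow> complex) \<Rightarrow> bool" where
  "planar_drawing E pos crv \<longleftrightarrow>
     (\<forall>e\<in>E. \<forall>f\<in>E. e \<noteq> f \<longrightarrow>
        path_image (crv e) \<inter> path_image (crv f) \<subseteq> pos ` ({fst e, snd e} \<inter> {fst f, snd f}))"

datatype hub = HA | HB | HC

datatype vtx = Hub hub | Pend hub nat

definition G_V :: "vtx set" where
  "G_V = range Hub \<union> {Pend h i | h i. i < 4}"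

definition G_E :: "(vtx \<times> vtx) set" where
  "G_E = {(Hub HA, Hub HB), (Hub HB, Hub HC), (Hub HC, Hub HA)} \<union>
         {(Hub h, Pend h i) | h i. i < 4}"

definition triangle_curve :: "((vtx \<times> vtx) \<Rightarrow> real \<Rightarrow> complex) \<Rightarrow> real \<Rightarrow> complex" where
  "triangle_curve crv =
     crv (Hub HA, Hub HB) +++ crv (Hub HB, Hub HC) +++ crv (Hub HC, Hub HA)"

definition respects_embedding :: "(vtx \<Rightarrow> complex) \<Rightarrow> ((vtx \<times> vtx) \<Rightarrow> real \<Rightarrow> complex) \<Rightarrow> bool" where
  "respects_embedding pos crv \<longleftrightarrow>
     (\<forall>i<4. path_image (crv (Hub HA, Pend HA i)) - {pos (Hub HA)}
               \<subseteq> outside (path_image (triangle_curve crv))) \<and>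
     (\<forall>i<4. path_image (crv (Hub HB, Pend HB i)) - {pos (Hub HB)}
               \<subseteq> outside (path_image (triangle_curve crv))) \<and>
     (\<forall>i<4. path_image (crv (Hub HC, Pend HC i)) - {pos (Hub HC)}
               \<subseteq> inside (path_image (triangle_curve crv)))"

end

theory Submission
  imports Defs
begin

text \<open>By the Jordan curve theorem the two triangle sides at each hub must be neighbours in the rotation,
  so they meet at angles of 60 degrees, with unknown orientation. The three circles then pairwise
  cross at 60 degrees. Multiplying the three angle conditions determines \<open>(k l m)\<^sup>2\<close>, where
  \<open>k\<close>, \<open>l\<close>, \<open>m\<close> are the half turning angles of the sides as unit complex numbers, and leaves
  only four cases up to symmetry. In three of them a hub lies on the opposite side or two sides
  cross a second time. In the remaining one the three angles have the same orientation, and one of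
  the two components of the complement of the circle through the hubs is disjoint from the triangle
  and is entered by a pendant edge at every hub. Hence the pendant edges at \<open>a\<close> and at \<open>c\<close> lie on the
  same side of the triangle, contrary to the embedding.\<close>

section \<open>Circular arcs\<close>

text \<open>The circular arc from \<open>p\<close> to \<open>q\<close> with turning angle \<open>d\<close>, where \<open>k = cis (d / 2)\<close>: by the inscribed
  angle theorem its inner points \<open>z\<close> are those for which \<open>(q - z) / (z - p)\<close> is a positive multiple
  of \<open>k\<close>. The tangent direction at \<open>p\<close> is then \<open>dir_start p q k\<close>.\<close>

definition arcset :: "complex \<Rightarrow> complex \<Rightarrow> complex \<Rightarrow> complex set" where
  "arcset p q k = insert p {z. \<exists>s\<ge>0. q - z = of_real s * k * (z - p)}"

text \<open>Solving \<open>q - z = of_real s * k * (z - p)\<close> for \<open>z\<close> divides by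
  \<open>1 + of_real s * k\<close>. This can vanish only if both summands have norm 1, which forces
  \<open>s = 1\<close> and \<open>k = -1\<close>.\<close>

lemma one_plus_real_mult_unit_nonzero:
  fixes k :: complex
  assumes "norm k = 1" "k \<noteq> -1" "0 \<le> s"
  shows "1 + of_real s * k \<noteq> 0"
proof
  assume eq: "1 + of_real s * k = 0"
  then have "of_real s * k = -1"
    by (simp add: add_eq_0_iff)
  moreover from this have "s = 1"
    using assms by (metis abs_of_nonneg mult.right_neutral norm_minus_cancel norm_mult norm_of_real norm_one)
  ultimately show False
    using assms by simp
qed

lemma cnj_eq_inverse_unit: "norm k = 1 \<Longrightarrow> cnj k = 1 / k"
  using complex_div_cnj[of 1 k] by simp

text \<open>Traversing the arc backwards negates the turning angle and replaces the factor
  \<open>s\<close> by \<open>1 / s\<close>. The value \<open>s = 0\<close> belongs to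
  \<open>q\<close>, the inserted base point of the reversed arc.\<close>

lemma arcset_reverse:
  assumes "norm k = 1" "p \<noteq> q"
  shows "arcset p q k = arcset q p (cnj k)"
proof -
  have *: "arcset p q k \<subseteq> arcset q p (cnj k)" if k: "norm k = 1" for p q k
  proof
    fix z assume z: "z \<in> arcset p q k"
    have kk: "k \<noteq> 0" using k by auto
    consider "z = p" | s where "s \<ge> 0" "q - z = of_real s * k * (z - p)"
      using z by (auto simp: arcset_def)
    then show "z \<in> arcset q p (cnj k)"
    proof cases
      case 1
      then show ?thesis by (auto simp: arcset_def intro!: exI[of _ 0])
    next
      case 2
      show ?thesis
      proof (cases "s = 0")
        case True
        then show ?thesis using 2 by (auto simp: arcset_def)
      next
        case False
        have "p - z = of_real (1/s) * cnj k * (z - q)"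
          using 2 False kk k by (simp add: cnj_eq_inverse_unit field_simps)
        then show ?thesis
          using 2 by (auto simp: arcset_def intro!: exI[of _ "1/s"])
      qed
    qed
  qed
  show ?thesis
    using *[of k p q] *[of "cnj k" q p] assms by auto
qed

lemma cis_diff: "cis u - cis v = 2 * \<i> * of_real (sin ((u - v) / 2)) * cis ((u + v) / 2)"
proof -
  have "cis u = cis ((u+v)/2) * cis ((u-v)/2)" "cis v = cis ((u+v)/2) * cis (-((u-v)/2))"
    by (simp_all add: cis_mult field_simps)
  then show ?thesis
    by (simp add: complex_eq_iff algebra_simps)
qed

text \<open>The tangent-chord angle is half the turning angle, hence the factor \<open>cnj k\<close>
  on the unit chord.\<close>

definition dir_start :: "complex \<Rightarrow> complex \<Rightarrow> complex \<Rightarrow> complex" where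
  "dir_start p q k = sgn (q - p) * cnj k"

lemma arcset_linepath:
  assumes "p \<noteq> q"
  shows "path_image (linepath p q) = arcset p q 1"
proof (intro equalityI subsetI)
  fix z assume "z \<in> path_image (linepath p q)"
  then obtain t where t: "0 \<le> t" "t \<le> 1" "z = (1 - t) *\<^sub>R p + t *\<^sub>R q"
    by (auto simp: path_image_def linepath_def)
  show "z \<in> arcset p q 1"
  proof (cases "t = 0")
    case True
    then show ?thesis using t by (simp add: arcset_def)
  next
    case False
    have "q - z = of_real ((1 - t) / t) * 1 * (z - p)"
      using False by (simp add: t(3) scaleR_conv_of_real field_simps)
    moreover have "(1 - t) / t \<ge> 0" using t by simp
    ultimately show ?thesis unfolding arcset_def by blast
  qed
next
  fix z assume "z \<in> arcset p q 1"
  then consider "z = p" | s where "s \<ge> 0" "q - z = of_real s * (z - p)"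
    by (auto simp: arcset_def)
  then show "z \<in> path_image (linepath p q)"
  proof cases
    case 1
    then show ?thesis by simp
  next
    case 2
    have n: "1 + complex_of_real s \<noteq> 0"
      using one_plus_real_mult_unit_nonzero[of 1 s] 2(1) by simp
    have z: "z = (q + of_real s * p) / (1 + of_real s)"
      using 2(2) n by (simp add: field_simps)
    have "1 - 1/(1+s) = s/(1+s)" using 2(1) by (simp add: field_simps)
    then have "linepath p q (1/(1+s)) = z"
      unfolding z linepath_def scaleR_conv_of_real using n by (simp add: add_divide_distrib)
    then show ?thesis
      using 2(1) unfolding path_image_def by (intro image_eqI[of _ _ "1/(1+s)"]) auto
  qed
qed

section \<open>Inscribed and tangent-chord angles of a parametrised circle\<close>

context
  fixes z :: complex and r th d :: real and g :: "real \<Rightarrow> complex"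
  assumes r: "r > 0" and d: "d \<noteq> 0" "\<bar>d\<bar> < 2 * pi"
  defines "g \<equiv> (\<lambda>t. z + rcis r (th + t * d))"
begin

text \<open>The angle \<open>x * d / 2\<close> lies strictly between 0 and \<open>pi\<close> in
  absolute value because \<open>\<bar>d\<bar> < 2 * pi\<close>, so its sine keeps the sign of
  \<open>d\<close>.\<close>

lemma half_turn_sin_sgn:
  assumes "0 < x" "x \<le> 1"
  shows "sgn (sin (x * d / 2)) = sgn d"
proof -
  have *: "sin (x * e / 2) > 0" if "0 < e" "e < 2 * pi" for e
  proof (rule sin_gt_zero)
    show "0 < x * e / 2" using that assms by simp
    have "x * e \<le> e" using that assms by simp
    then show "x * e / 2 < pi" using that by linarith
  qed
  show ?thesis
    using *[of d] *[of "- d"] d by (cases "d > 0") auto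
qed

text \<open>A chord is perpendicular to the radius at the mean parameter, with signed length
  \<open>2 * r * sin ((t - u) * d / 2)\<close>. Two chords are thus compared by a ratio of sines and
  a rotation.\<close>

lemma circle_diff:
  "g t - g u = 2 * \<i> * of_real (r * sin ((t - u) * d / 2)) * cis (th + (t + u) * d / 2)"
proof -
  have "g t - g u = of_real r * (cis (th + t * d) - cis (th + u * d))"
    by (simp add: g_def rcis_def algebra_simps)
  also have "\<dots> = of_real r * (2 * \<i> * of_real (sin ((t - u) * d / 2)) * cis (th + (t + u) * d / 2))"
    unfolding cis_diff by (simp add: algebra_simps add_divide_distrib diff_divide_distrib)
  finally show ?thesis by (simp add: algebra_simps)
qed

lemma circle_inj:
  assumes "g t = g u" "t \<in> {0..1}" "u \<in> {0..1}"
  shows "t = u"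
proof -
  have *: "g t \<noteq> g u" if "u < t" "t \<in> {0..1}" "u \<in> {0..1}" for t u
  proof -
    have "sgn (sin ((t - u) * d / 2)) = sgn d"
      using that by (intro half_turn_sin_sgn) auto
    then have "sin ((t - u) * d / 2) \<noteq> 0" using d by (metis sgn_0 sgn_0_0)
    then have "g t - g u \<noteq> 0" unfolding circle_diff using r by simp
    then show ?thesis by simp
  qed
  show ?thesis
    using *[of t u] *[of u t] assms by (metis linorder_neqE_linordered_idom)
qed

lemma arc_circle: "arc g"
  unfolding arc_def path_def
proof
  show "continuous_on {0..1} g"
    unfolding g_def rcis_def cis_conv_exp by (intro continuous_intros)
  show "inj_on g {0..1}"
    using circle_inj by (auto simp: inj_on_def)
qed

lemma half_turn_not_minus_one: "cis (d / 2) \<noteq> -1"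
proof
  assume "cis (d / 2) = -1"
  then have "sin (d/2) = 0" by (simp add: complex_eq_iff)
  then show False using half_turn_sin_sgn[of 1] d by (simp add: sgn_zero_iff)
qed

text \<open>The inscribed angle theorem: at an inner point the quotient of the two chords to the
  ends is a positive ratio of sines times \<open>cis (d / 2)\<close>. Conversely, each ratio
  \<open>s\<close> is attained by continuity, and it determines the point.\<close>

lemma path_image_circle: "path_image g = arcset (g 0) (g 1) (cis (d / 2))"
proof (intro equalityI subsetI)
  fix w assume "w \<in> path_image g"
  then obtain t where t: "0 \<le> t" "t \<le> 1" "w = g t"
    by (auto simp: path_image_def)
  show "w \<in> arcset (g 0) (g 1) (cis (d / 2))"
  proof (cases "t = 0 \<or> t = 1")
    case True
    then show ?thesis using t by (auto simp: arcset_def intro!: exI[of _ 0])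
  next
    case False
    define s where "s = sin ((1 - t) * d / 2) / sin (t * d / 2)"
    have sg: "sgn (sin ((1 - t) * d / 2)) = sgn d" "sgn (sin (t * d / 2)) = sgn d"
      using t False by (auto intro!: half_turn_sin_sgn)
    have "sgn s = 1"
      unfolding s_def sgn_divide using sg d by (simp add: sgn_if)
    then have s: "s > 0" by (simp add: sgn_1_pos)
    have n: "sin (t * d / 2) \<noteq> 0" using sg d by (metis sgn_0 sgn_0_0)
    have "sin ((1 - t) * d / 2) = s * sin (t * d / 2)"
      using n by (simp add: s_def)
    moreover have "cis (th + (1 + t) * d / 2) = cis (d/2) * cis (th + t * d / 2)"
      by (simp add: cis_mult field_simps)
    ultimately have "g 1 - w = of_real s * cis (d/2) * (w - g 0)"
      unfolding t(3) circle_diff by simp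
    then show ?thesis
      using s unfolding arcset_def by (auto intro!: exI[of _ s])
  qed
next
  fix w assume "w \<in> arcset (g 0) (g 1) (cis (d / 2))"
  then consider "w = g 0" | s where "s \<ge> 0" "g 1 - w = of_real s * cis (d/2) * (w - g 0)"
    by (auto simp: arcset_def)
  then show "w \<in> path_image g"
  proof cases
    case 1
    then show ?thesis by (auto simp: path_image_def)
  next
    case 2
    \<comment> \<open>A zero of \<open>h\<close> is a parameter at which the ratio of sines is
      \<open>s\<close>. The factor \<open>sgn d\<close> gives the same signs at the ends for both
      directions of traversal.\<close>
    define h where "h t = (sin ((1 - t) * d / 2) - s * sin (t * d / 2)) * sgn d" for t
    have sg: "sgn (sin (d / 2)) = sgn d" using half_turn_sin_sgn[of 1] by simp
    have pos: "sin (d / 2) * sgn d \<ge> 0"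
      unfolding sg[symmetric] by (metis abs_ge_zero abs_sgn mult.commute)
    then have ends: "h 0 \<ge> 0" "h 1 \<le> 0"
      using 2(1) by (simp_all add: h_def mult.assoc)
    have "\<exists>t\<ge>0. t \<le> 1 \<and> h t = 0"
      using ends unfolding h_def by (intro IVT2') (auto intro!: continuous_intros)
    then obtain t where t: "0 \<le> t" "t \<le> 1" "h t = 0" by blast
    then have e: "sin ((1 - t) * d / 2) = s * sin (t * d / 2)"
      using d by (simp add: h_def sgn_0_0)
    have "cis (th + (1 + t) * d / 2) = cis (d/2) * cis (th + t * d / 2)"
      by (simp add: cis_mult field_simps)
    then have "g 1 - g t = of_real s * cis (d/2) * (g t - g 0)"
      unfolding circle_diff e by simp
    \<comment> \<open>Both \<open>w\<close> and \<open>g t\<close> solve the same affine equation,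
      whose leading coefficient is nonzero.\<close>
    with 2(2) have "(w - g t) * (1 + of_real s * cis (d/2)) = 0"
      by (simp add: algebra_simps)
    then have "w = g t"
      using one_plus_real_mult_unit_nonzero[OF _ half_turn_not_minus_one 2(1)] by simp
    then show ?thesis using t by (auto simp: path_image_def)
  qed
qed

lemma circle_chord_sgn: "sgn (g 1 - g 0) = of_real (sgn d) * \<i> * cis (th + d / 2)"
proof -
  have "sgn (g 1 - g 0) = of_real (sgn (sin (d/2))) * \<i> * cis (th + d / 2)"
    unfolding circle_diff using r
    by (simp add: sgn_mult sgn_of_real) (simp add: sgn_eq)
  then show ?thesis using half_turn_sin_sgn[of 1] by simp
qed

lemma circle_derivative:
  assumes "t \<in> {0..1}"
  shows "sgn (vector_derivative g (at t within {0..1})) = of_real (sgn d) * \<i> * cis (th + t * d)"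
proof -
  have "(g has_vector_derivative (of_real (r * d) * \<i> * cis (th + t * d))) (at t within {0..1})"
    unfolding g_def rcis_def has_vector_derivative_def
    by (auto intro!: derivative_eq_intros simp: scaleR_conv_of_real algebra_simps)
  then have "vector_derivative g (at t within {0..1}) = of_real (r * d) * \<i> * cis (th + t * d)"
    using assms by (intro vector_derivative_within_cbox[of 0 1, simplified]) auto
  then show ?thesis using r
    by (simp add: sgn_mult sgn_of_real) (simp add: sgn_eq)
qed

end

text \<open>From here on an edge is its end points and a unit number: \<open>k = 1\<close> for a
  segment, \<open>k = cis (d / 2)\<close> for a circular arc. At the finish the outgoing tangent is
  that of the reversed arc, hence \<open>cnj k\<close>.\<close>

lemma circ_arc_arcset:
  assumes "circ_arc g"
  obtains k where "norm k = 1" "k \<noteq> -1" "arc g"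
    "path_image g = arcset (pathstart g) (pathfinish g) k"
    "sgn (vector_derivative g (at 0 within {0..1})) = dir_start (pathstart g) (pathfinish g) k"
    "sgn (- vector_derivative g (at 1 within {0..1})) = dir_start (pathfinish g) (pathstart g) (cnj k)"
  using assms unfolding circ_arc_def
proof (elim disjE exE conjE)
  fix p q assume pq: "p \<noteq> q" "g = linepath p q"
  have v: "vector_derivative g (at t within {0..1}) = q - p" if "t \<in> {0..1}" for t
    unfolding pq(2) using that
    by (intro vector_derivative_within_cbox[of 0 1, simplified]) (auto intro: has_vector_derivative_linepath_within)
  show thesis
    by (rule that[of 1]) (use pq v[of 0] v[of 1] arcset_linepath[OF pq(1)] in \<open>auto simp: dir_start_def\<close>)
next
  fix z r th d assume c: "r > 0" "d \<noteq> 0" "\<bar>d\<bar> < 2 * pi" "g = (\<lambda>t. z + rcis r (th + t * d))"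
  have "sgn (vector_derivative g (at 0 within {0..1})) = dir_start (pathstart g) (pathfinish g) (cis (d/2))"
    using circle_derivative[OF c(1-3), of 0 z th] circle_chord_sgn[OF c(1-3), of z th] c(4)
    by (simp add: dir_start_def pathstart_def pathfinish_def mult.assoc cis_cnj cis_mult)
  moreover have "sgn (- vector_derivative g (at 1 within {0..1})) = dir_start (pathfinish g) (pathstart g) (cnj (cis (d/2)))"
  proof -
    have "sgn (g 0 - g 1) = - sgn (g 1 - g 0)" by (metis minus_diff_eq sgn_minus)
    then show ?thesis
      using circle_derivative[OF c(1-3), of 1 z th] circle_chord_sgn[OF c(1-3), of z th] c(4)
      by (simp add: dir_start_def pathstart_def pathfinish_def mult.assoc cis_mult add.commute)
  qed
  ultimately show thesis
    using that[of "cis (d/2)"] arc_circle[OF c(1-3)] half_turn_not_minus_one[OF c(1-3)]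
      path_image_circle[OF c(1-3)] c(4) by (simp add: pathstart_def pathfinish_def)
qed

section \<open>Angles of triangles with circular sides\<close>

text \<open>Tangent conditions relate unit vectors, while arc equations relate the vectors
  themselves. Restoring the lengths costs only a positive real factor.\<close>

lemma scale_of_sgn_eq:
  fixes u v k w :: complex
  assumes "k * sgn u = w * sgn v" "u \<noteq> 0"
  shows "of_real (norm v / norm u) * k * u = w * v"
proof -
  have *: "z = of_real (norm z) * sgn z" for z :: complex
    by (simp add: sgn_eq)
  have "of_real (norm v / norm u) * k * u = of_real (norm v / norm u) * k * (of_real (norm u) * sgn u)"
    using *[of u] by simp
  also have "\<dots> = of_real (norm v) * (k * sgn u)"
    using assms(2) by simp
  also have "\<dots> = w * v"
    unfolding assms(1) using *[of v] by (metis mult.left_commute)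
  finally show ?thesis .
qed

text \<open>The hypothesis makes \<open>(B - C) / (C - A)\<close> a positive multiple of
  \<open>k\<close>, which is the inscribed angle condition for \<open>C\<close>.\<close>

lemma opposite_vertex_on_arc:
  assumes "A \<noteq> C" "k * sgn (A - C) = sgn (C - B)"
  shows "C \<in> arcset A B k"
proof -
  have "B - C = of_real (norm (C - B) / norm (A - C)) * k * (C - A)"
    using scale_of_sgn_eq[of k "A - C" 1 "C - B"] assms
    by (metis minus_diff_eq mult_1 mult_minus_right right_minus_eq)
  then show ?thesis
    unfolding arcset_def by (auto intro!: exI[of _ "norm (C - B) / norm (A - C)"])
qed

text \<open>The second common point is an isodynamic point of the triangle: its distances to
  \<open>A\<close>, \<open>B\<close>, \<open>C\<close> are inversely proportional to the opposite
  sides. This prescribes the factors \<open>s\<close> and \<open>t\<close> in the two arc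
  equations.\<close>

lemma arcs_cross:
  fixes e :: complex
  assumes dist: "A \<noteq> B" "B \<noteq> C" "C \<noteq> A" and e: "e\<^sup>2 - e + 1 = 0"
    and l: "norm l = 1" "l \<noteq> -1" "l * sgn (B - A) = - sgn (A - C) * e\<^sup>2"
    and m: "m * sgn (C - B) = - sgn (B - A) * e\<^sup>2"
  shows "\<exists>z. z \<noteq> C \<and> z \<in> arcset B C l \<and> z \<in> arcset C A m"
proof -
  define s t where "s = norm (A - C) / norm (B - A)" and "t = norm (B - A) / norm (C - B)"
  have st: "s \<ge> 0" "t \<ge> 0" "s \<noteq> 0" using dist by (auto simp: s_def t_def)
  have S: "of_real s * l * (B - A) = (C - A) * e\<^sup>2"
    using scale_of_sgn_eq[of l "B - A" "- (e\<^sup>2)" "A - C"] l(3) dist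
    by (simp add: s_def algebra_simps)
  have T: "of_real t * m * (C - B) = (A - B) * e\<^sup>2"
    using scale_of_sgn_eq[of m "C - B" "- (e\<^sup>2)" "B - A"] m dist
    by (simp add: t_def algebra_simps)
  have n: "1 + of_real s * l \<noteq> 0" using one_plus_real_mult_unit_nonzero l st by blast
  define z where "z = (C + of_real s * l * B) / (1 + of_real s * l)"
  have z: "z * (1 + of_real s * l) = C + of_real s * l * B" using n by (simp add: z_def)
  have 1: "C - z = of_real s * l * (z - B)" using z by (simp add: algebra_simps)
  have l0: "of_real s * l \<noteq> 0" using l st by auto
  have "z \<noteq> C" using 1 l0 dist by auto
  moreover have "z \<in> arcset B C l" using 1 st unfolding arcset_def by auto
  moreover have "A - z = of_real t * m * (z - C)"
  proof -
    define L where "L = of_real s * l"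
    define M where "M = of_real t * m"
    \<comment> \<open>Cleared of denominators, the second arc equation is a polynomial consequence
      of \<open>z\<close>, \<open>S\<close>, \<open>T\<close> and the equation of
      \<open>e\<close>.\<close>
    have "(A - z - M * (z - C)) * ((1 + L) * (B - A) * (C - B)) = 0"
      using z S T e unfolding L_def[symmetric] M_def[symmetric] by algebra
    then show ?thesis
      using n dist by (simp add: L_def M_def)
  qed
  ultimately show ?thesis using st unfolding arcset_def by blast
qed

text \<open>Here \<open>X\<close>, \<open>Y\<close>, \<open>Z\<close> stand for the unit chords, and
  the angle at the third hub has the opposite orientation. The product of the three conditions gives
  \<open>T\<^sup>2 = - ja\<close> for \<open>T = k * l * m\<close>. One root puts \<open>C\<close>
  on the opposite side, the other makes two sides cross again.\<close>

lemma triangle_angle_odd: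
  fixes X Y Z k l m ja jb jc :: complex
  assumes "X \<noteq> 0" "Y \<noteq> 0" "Z \<noteq> 0" "ja\<^sup>2 - ja + 1 = 0" "jb = ja" "jc = 1 - ja"
    "ja * X = - Z * m * k" "jb * Y = - X * k * l" "jc * Z = - Y * l * m"
  shows "k * Z = Y \<or> (\<exists>e. e\<^sup>2 - e + 1 = 0 \<and> l * X = - Z * e\<^sup>2 \<and> m * Y = - X * e\<^sup>2)"
proof -
  define T where "T = k * l * m"
  have ja0: "ja \<noteq> 0" using assms(4) by auto
  have kk: "jc * Z * k = - Y * T" "ja * X * l = - Z * T" "jb * Y * m = - X * T"
    using assms(7-9) by (simp_all add: T_def)
  have "(jb * Y) * (jc * Z) * (ja * X) = - (T\<^sup>2) * (X * Y * Z)"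
    unfolding assms(7-9) by (simp add: T_def algebra_simps power2_eq_square)
  then have "(X * Y * Z) * (ja * jb * jc + T\<^sup>2) = 0"
    by (simp add: algebra_simps)
  then have "ja * jb * jc + T\<^sup>2 = 0" using assms(1-3) by auto
  then have "T\<^sup>2 + ja = 0" using assms(4-6) by algebra
  then have "(T - ja\<^sup>2) * (T + ja\<^sup>2) = 0" using assms(4) by algebra
  then consider "T = ja\<^sup>2" | "T = - (ja\<^sup>2)" by (auto simp: add_eq_0_iff2)
  then show ?thesis
  proof cases
    case 1
    have "k * Z = Y" using 1 kk(1) assms(4,6) by algebra
    then show ?thesis by simp
  next
    case 2
    have "ja * (l * X - Z * ja) = 0" using 2 kk(2) by algebra
    then have "l * X = Z * ja" using ja0 by simp
    moreover have "ja * (m * Y - X * ja) = 0" using 2 kk(3) assms(5) by algebra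
    then have "m * Y = X * ja" using ja0 by simp
    moreover have "(1 - ja)\<^sup>2 = - ja" "(1 - ja)\<^sup>2 - (1 - ja) + 1 = 0"
      using assms(4) by algebra+
    \<comment> \<open>The conjugate root \<open>1 - ja\<close> is the witness because its square is
      \<open>- ja\<close>.\<close>
    ultimately show ?thesis by (intro disjI2 exI[of _ "1 - ja"]) simp
  qed
qed

text \<open>With equal orientations \<open>j ^ 3 = -1\<close>, so the product of the conditions
  gives \<open>T\<^sup>2 = 1\<close>. The root \<open>-1\<close> leads to a second crossing; the
  root \<open>1\<close> is the case settled by the circle through the hubs.\<close>

lemma triangle_angle_equal:
  fixes X Y Z k l m j :: complex
  assumes "X \<noteq> 0" "Y \<noteq> 0" "Z \<noteq> 0" "j\<^sup>2 - j + 1 = 0"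
    "j * X = - Z * m * k" "j * Y = - X * k * l" "j * Z = - Y * l * m"
  shows "(l * X = - Z * j\<^sup>2 \<and> m * Y = - X * j\<^sup>2) \<or>
    (k * Z = - Y * (1 - j) \<and> l * X = - Z * (1 - j) \<and> m * Y = - X * (1 - j))"
proof -
  define T where "T = k * l * m"
  have kk: "j * Z * k = - Y * T" "j * X * l = - Z * T" "j * Y * m = - X * T"
    using assms(5-7) by (simp_all add: T_def)
  have "(j * Y) * (j * Z) * (j * X) = - (T\<^sup>2) * (X * Y * Z)"
    unfolding assms(5-7) by (simp add: T_def algebra_simps power2_eq_square)
  then have "(X * Y * Z) * (j ^ 3 + T\<^sup>2) = 0"
    by (simp add: algebra_simps power3_eq_cube)
  then have "j ^ 3 + T\<^sup>2 = 0" using assms(1-3) by auto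
  then have "(T - 1) * (T + 1) = 0" using assms(4) by algebra
  then consider "T = 1" | "T = -1" by (auto simp: add_eq_0_iff2)
  then show ?thesis
  proof cases
    case 1
    have "k * Z = - Y * (1 - j)" "l * X = - Z * (1 - j)" "m * Y = - X * (1 - j)"
      using 1 kk assms(4) by algebra+
    then show ?thesis by simp
  next
    case 2
    have "l * X = - Z * j\<^sup>2" "m * Y = - X * j\<^sup>2"
      using 2 kk assms(4) by algebra+
    then show ?thesis by simp
  qed
qed

section \<open>The coordinate at a vertex\<close>

text \<open>A Moebius coordinate that sends \<open>V\<close> to infinity and the arc from \<open>V\<close> to \<open>Q\<close> to the nonnegative
  reals. Every other arc leaving \<open>V\<close> becomes a ray whose direction is the quotient of the tangents.\<close>

definition zeta :: "complex \<Rightarrow> complex \<Rightarrow> complex \<Rightarrow> complex \<Rightarrow> complex" where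
  "zeta V Q k z = (Q - z) / ((z - V) * k)"

text \<open>The value \<open>u = - 1 / k\<close> is the coordinate of the point at infinity; there
  division by zero yields \<open>V\<close>.\<close>

definition zeta_inv :: "complex \<Rightarrow> complex \<Rightarrow> complex \<Rightarrow> complex \<Rightarrow> complex" where
  "zeta_inv V Q k u = V + (Q - V) / (1 + u * k)"

lemma zeta_alt: "z \<noteq> V \<Longrightarrow> zeta V Q k z = ((Q - V) / (z - V) - 1) / k"
  by (simp add: zeta_def divide_simps)

lemma zeta_zeta_inv:
  assumes "V \<noteq> Q" "k \<noteq> 0" "1 + u * k \<noteq> 0"
  shows "zeta V Q k (zeta_inv V Q k u) = u" "zeta_inv V Q k u \<noteq> V"
proof -
  show n: "zeta_inv V Q k u \<noteq> V" using assms by (simp add: zeta_inv_def)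
  show "zeta V Q k (zeta_inv V Q k u) = u"
    unfolding zeta_alt[OF n] using assms by (simp add: zeta_inv_def)
qed

lemma zeta_inv_zeta:
  assumes "V \<noteq> Q" "k \<noteq> 0" "z \<noteq> V"
  shows "zeta_inv V Q k (zeta V Q k z) = z" "1 + zeta V Q k z * k \<noteq> 0"
  using assms by (simp_all add: zeta_inv_def zeta_alt)

lemma arcset_minus_start:
  assumes "V \<noteq> Q" "norm k = 1" "k \<noteq> -1"
  shows "arcset V Q k - {V} = (\<lambda>s. zeta_inv V Q k (of_real s)) ` {0..}"
proof (intro equalityI subsetI)
  have k0: "k \<noteq> 0" using assms by auto
  {
    fix z assume "z \<in> arcset V Q k - {V}"
    then obtain s where s: "s \<ge> 0" "Q - z = of_real s * k * (z - V)" "z \<noteq> V"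
      by (auto simp: arcset_def)
    then have "zeta V Q k z = of_real s" using k0 by (simp add: zeta_def)
    then show "z \<in> (\<lambda>s. zeta_inv V Q k (of_real s)) ` {0..}"
      using zeta_inv_zeta(1)[OF assms(1) k0 s(3)] s(1) by force
  next
    fix z assume "z \<in> (\<lambda>s. zeta_inv V Q k (of_real s)) ` {0..}"
    then obtain s where s: "s \<ge> 0" "z = zeta_inv V Q k (of_real s)" by auto
    note n = one_plus_real_mult_unit_nonzero[OF assms(2,3) s(1)]
    have "zeta V Q k z = of_real s" "z \<noteq> V" using zeta_zeta_inv[OF assms(1) k0 n] s by auto
    then have "Q - z = of_real s * k * (z - V)" using k0 by (simp add: zeta_def field_simps)
    then show "z \<in> arcset V Q k - {V}" using s \<open>z \<noteq> V\<close> by (auto simp: arcset_def)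
  }
qed

text \<open>Both coordinates send \<open>V\<close> to infinity, so the change of coordinates is
  affine and maps rays to rays. The tangent of the arc is in the denominator because
  \<open>zeta\<close> behaves like a multiple of \<open>1 / (z - V)\<close> near
  \<open>V\<close>.\<close>

lemma zeta_arcset:
  assumes "V \<noteq> Q" "norm k = 1" "k \<noteq> -1" "V \<noteq> Q'" "norm k' = 1"
  obtains a c where "c > 0"
    "zeta V Q' k' ` (arcset V Q k - {V}) =
      (\<lambda>s. a + of_real s * of_real c * (dir_start V Q' k' / dir_start V Q k)) ` {0..}"
proof
  have k0: "k \<noteq> 0" "k' \<noteq> 0" using assms by auto
  show "norm (Q' - V) / norm (Q - V) > 0" using assms by simp
  have *: "of_real (norm (Q' - V) / norm (Q - V)) * (dir_start V Q' k' / dir_start V Q k)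
      = (Q' - V) / (Q - V) * k / k'"
    using assms by (simp add: dir_start_def cnj_eq_inverse_unit sgn_eq)
  have aux: "(a * (1 + t * k) / b - 1) / k' = (a / b - 1) / k' + t * (a / b * k / k')" for a b t :: complex
    by (simp add: distrib_left add_divide_distrib diff_divide_distrib mult_ac)
  have "zeta V Q' k' (zeta_inv V Q k (of_real s)) = ((Q' - V) / (Q - V) - 1) / k'
      + of_real s * of_real (norm (Q' - V) / norm (Q - V)) * (dir_start V Q' k' / dir_start V Q k)"
    if "s \<ge> 0" for s
  proof -
    note n = one_plus_real_mult_unit_nonzero[OF assms(2,3) that]
    show ?thesis
      unfolding mult.assoc[of "of_real s"] * zeta_alt[OF zeta_zeta_inv(2)[OF assms(1) k0(1) n]]
      unfolding zeta_inv_def add_diff_cancel_left' divide_divide_eq_right by (rule aux)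
  qed
  then show "zeta V Q' k' ` (arcset V Q k - {V}) =
      (\<lambda>s. ((Q' - V) / (Q - V) - 1) / k' + of_real s * of_real (norm (Q' - V) / norm (Q - V))
        * (dir_start V Q' k' / dir_start V Q k)) ` {0..}"
    unfolding arcset_minus_start[OF assms(1-3)] image_image by (intro image_cong) auto
qed

text \<open>The rotated coordinates at \<open>A\<close> and \<open>C\<close> are related by
  \<open>v = - (p * q) / (p + u)\<close> with \<open>p\<close> and \<open>q\<close> positive, a real
  Moebius map that preserves the upper half plane. The real line in either coordinate is the circle
  (or line) through the hubs.\<close>

lemma Im_zeta_rotate:
  fixes e :: complex
  assumes dist: "A \<noteq> B" "B \<noteq> C" "C \<noteq> A" and e: "e \<noteq> 0"
    and k: "k * sgn (A - C) = - sgn (C - B) * e"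
    and m: "m * sgn (C - B) = - sgn (B - A) * e"
    and z: "z \<noteq> A" "z \<noteq> C"
  shows "sgn (Im (e * zeta C A m z)) = sgn (Im (e * zeta A B k z))"
proof -
  define P Q where "P = norm (C - B) / norm (A - C)" and "Q = norm (B - A) / norm (C - B)"
  have pq: "P > 0" "Q > 0" using dist by (auto simp: P_def Q_def)
  have sg: "sgn (A - C) \<noteq> 0" "sgn (C - B) \<noteq> 0" "sgn (B - A) \<noteq> 0"
    using dist by (auto simp: sgn_zero_iff)
  have K: "of_real P * k * (A - C) = - (C - B) * e"
    using scale_of_sgn_eq[of k "A - C" "- e" "C - B"] k dist by (simp add: P_def algebra_simps)
  have M: "of_real Q * m * (C - B) = - (B - A) * e"
    using scale_of_sgn_eq[of m "C - B" "- e" "B - A"] m dist by (simp add: Q_def algebra_simps)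
  have k0: "k \<noteq> 0" using k sg e by auto
  have m0: "m \<noteq> 0" using m sg e by auto
  define u v where "u = e * zeta A B k z" and "v = e * zeta C A m z"
  have U: "u * ((z - A) * k) = e * (B - z)" using k0 z by (simp add: u_def zeta_def)
  have V: "v * ((z - C) * m) = e * (A - z)" using m0 z by (simp add: v_def zeta_def)
  define p q where "p = complex_of_real P" and "q = complex_of_real Q"
  have "(v * (p + u) + p * q) * ((z - A) * k * ((z - C) * m)) = 0"
  proof -
    have "(v * (p + u) + p * q) * ((z - A) * k * ((z - C) * m)) * ((A - C) * (C - B)) = 0"
      using U V K M unfolding p_def[symmetric] q_def[symmetric] by algebra
    then show ?thesis using dist by simp
  qed
  then have rel: "v * (p + u) = - (p * q)"
    using k0 m0 z by (simp add: add_eq_0_iff2)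
  then have n: "p + u \<noteq> 0" using pq by (auto simp: p_def q_def)
  then have "v = - of_real (P * Q) / (p + u)"
    using rel by (simp add: p_def q_def field_simps)
  also have "\<dots> = of_real (P * Q / (norm (p + u))\<^sup>2) * - cnj (p + u)"
    by (subst complex_div_cnj) (simp add: add_divide_distrib diff_divide_distrib distrib_left right_diff_distrib)
  finally have "Im v = P * Q / (norm (p + u))\<^sup>2 * Im u"
    by (simp add: p_def)
  then show ?thesis
    unfolding u_def[symmetric] v_def[symmetric] using pq n by (simp add: sgn_mult)
qed

lemma two_affine_large:
  fixes a b a' b' M M' :: real
  assumes "b > 0" "b' > 0"
  obtains s where "s \<ge> 0" "a + s * b > M" "a' + s * b' > M'"
proof
  define s where "s = \<bar>M - a\<bar> / b + \<bar>M' - a'\<bar> / b' + 1"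
  show "s \<ge> 0" using assms by (simp add: s_def)
  have "s * b = \<bar>M - a\<bar> + \<bar>M' - a'\<bar> / b' * b + b" "s * b' = \<bar>M' - a'\<bar> + \<bar>M - a\<bar> / b * b' + b'"
    using assms by (simp_all add: s_def distrib_right)
  moreover have "\<bar>M' - a'\<bar> / b' * b \<ge> 0" "\<bar>M - a\<bar> / b * b' \<ge> 0"
    using assms by simp_all
  ultimately show "a + s * b > M" "a' + s * b' > M'"
    using assms by linarith+
qed

text \<open>If, on either side of the arc from \<open>V\<close> to \<open>Q\<close>, a pendant arc at \<open>V\<close> lies in \<open>X\<close>, then both sides
  of that arc near \<open>V\<close> belong to \<open>X\<close>: in the coordinate \<open>zeta\<close> they contain quarter planes far to the
  right that avoid \<open>S\<close>. So \<open>Y\<close> cannot accumulate there.\<close>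

lemma curve_on_both_sides_of_arc:
  assumes V: "V \<noteq> Q" "norm k = 1" "k \<noteq> -1" "V \<noteq> Q'" "norm k' = 1" "k' \<noteq> -1"
    and R: "closed R" "V \<notin> R"
    and S: "S = arcset V Q k \<union> arcset V Q' k' \<union> R"
    and turn: "Re (dir_start V Q k / dir_start V Q' k') < 0"
    and pend: "\<And>t. t \<in> {1, -1} \<Longrightarrow> \<exists>P n. V \<noteq> P \<and> norm n = 1 \<and> n \<noteq> -1 \<and> arcset V P n - {V} \<subseteq> X \<and>
        Re (dir_start V Q k / dir_start V P n) > 0 \<and> t * Im (dir_start V Q k / dir_start V P n) > 0"
    and comp: "\<And>T. connected T \<Longrightarrow> T \<inter> S = {} \<Longrightarrow> T \<inter> X \<noteq> {} \<Longrightarrow> T \<inter> Y = {}"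
    and Y: "S \<subseteq> closure Y" "Y \<inter> S = {}"
  shows False
proof -
  have k0: "k \<noteq> 0" using V by auto
  define b where "b = dir_start V Q k / dir_start V Q' k'"
  obtain a c where ac: "c > 0" "zeta V Q k ` (arcset V Q' k' - {V}) =
      (\<lambda>s. a + of_real s * of_real c * b) ` {0..}"
    unfolding b_def using zeta_arcset[OF V(4-6) V(1,2)] .
  obtain \<delta> where \<delta>: "\<delta> > 0" "\<And>z. z \<in> R \<Longrightarrow> \<delta> \<le> norm (z - V)"
    using separate_point_closed[OF R] by (auto simp: dist_norm norm_minus_commute)
  \<comment> \<open>Beyond \<open>M\<close> the pole of \<open>zeta_inv\<close> is avoided by the
    bound 1, the other side by \<open>Re a\<close>, as its ray runs to the left, and
    \<open>R\<close> by its distance \<open>\<delta>\<close> from \<open>V\<close>.\<close>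
  define M where "M = max 1 (max (Re a) (norm (Q - V) / \<delta> + 1))"
  have far: "z \<in> arcset V Q k" if z: "z \<in> S" "z \<noteq> V" "Re (zeta V Q k z) > M" for z
  proof (rule ccontr)
    assume "z \<notin> arcset V Q k"
    then consider "z \<in> arcset V Q' k' - {V}" | "z \<in> R" using z S by auto
    then show False
    proof cases
      case 1
      then have "zeta V Q k z \<in> zeta V Q k ` (arcset V Q' k' - {V})" by (rule imageI)
      then obtain s where s: "s \<ge> 0"
        "zeta V Q k z = a + of_real s * of_real c * b"
        unfolding ac(2) by auto
      have "Re (zeta V Q k z) = Re a + s * c * Re b"
        unfolding s(2) by (simp flip: of_real_mult)
      moreover have "s * c * Re b \<le> 0"
        using s(1) ac(1) turn unfolding b_def by (intro mult_nonneg_nonpos) auto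
      ultimately show False using z(3) by (simp add: M_def)
    next
      case 2
      have "Re (zeta V Q k z) \<le> norm ((Q - V) / (z - V) - 1)"
        using complex_Re_le_cmod[of "zeta V Q k z"] V(2) z(2) by (simp add: zeta_alt norm_divide)
      also have "\<dots> \<le> norm (Q - V) / norm (z - V) + 1"
        using norm_triangle_ineq4[of "(Q - V) / (z - V)" 1] by (simp add: norm_divide)
      also have "\<dots> \<le> norm (Q - V) / \<delta> + 1"
        using \<delta> 2 z(2) by (intro add_right_mono divide_left_mono) auto
      finally show False using z(3) by (simp add: M_def)
    qed
  qed
  have nz: "1 + u * k \<noteq> 0" if "Re u > M" for u
  proof
    assume "1 + u * k = 0"
    then have "u * k = -1" by (simp add: add_eq_0_iff)
    then have "norm (u * k) = 1" by simp
    then show False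
      using that complex_Re_le_cmod[of u] V(2) by (simp add: norm_mult M_def)
  qed
  \<comment> \<open>Each quarter plane is connected, avoids \<open>S\<close> and contains far points
    of a pendant arc in \<open>X\<close>, so \<open>comp\<close> excludes \<open>Y\<close> from
    it.\<close>
  have side: "zeta_inv V Q k ` {u. Re u > M \<and> t * Im u > 0} \<inter> Y = {}" if t: "t \<in> {1, -1}" for t :: real
  proof (rule comp)
    have "convex ({u. Re u > M} \<inter> {u. Im u > 0})" "convex ({u. Re u > M} \<inter> {u. Im u < 0})"
      by (intro convex_Int convex_halfspace_Re_gt convex_halfspace_Im_gt convex_halfspace_Im_lt)+
    moreover have "{u. Re u > M \<and> t * Im u > 0} = {u. Re u > M} \<inter> {u. Im u > 0} \<or>
        {u. Re u > M \<and> t * Im u > 0} = {u. Re u > M} \<inter> {u. Im u < 0}"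
      using t by (elim insertE) (simp_all add: Int_def)
    ultimately have "convex {u. Re u > M \<and> t * Im u > 0}" by (elim disjE) simp_all
    moreover have "continuous_on {u. Re u > M \<and> t * Im u > 0} (zeta_inv V Q k)"
      unfolding zeta_inv_def using nz by (intro continuous_intros) auto
    ultimately show "connected (zeta_inv V Q k ` {u. Re u > M \<and> t * Im u > 0})"
      by (intro connected_continuous_image convex_connected)
    show "zeta_inv V Q k ` {u. Re u > M \<and> t * Im u > 0} \<inter> S = {}"
    proof (rule ccontr)
      assume "\<not> ?thesis"
      then obtain u where u: "Re u > M" "t * Im u > 0" "zeta_inv V Q k u \<in> S" by auto
      note zz = zeta_zeta_inv[OF V(1) k0 nz[OF u(1)]]
      have "zeta_inv V Q k u \<in> arcset V Q k - {V}"
        using far[OF u(3) zz(2)] u(1) zz by simp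
      then obtain s where s: "s \<ge> 0" "zeta_inv V Q k u = zeta_inv V Q k (of_real s)"
        unfolding arcset_minus_start[OF V(1-3)] by auto
      have "u = of_real s"
        using zz(1) s(2) zeta_zeta_inv(1)[OF V(1) k0 one_plus_real_mult_unit_nonzero[OF V(2,3) s(1)]]
        by simp
      then show False using u(2) by simp
    qed
    obtain P n where P: "V \<noteq> P" "norm n = 1" "n \<noteq> -1" "arcset V P n - {V} \<subseteq> X"
      "Re (dir_start V Q k / dir_start V P n) > 0" "t * Im (dir_start V Q k / dir_start V P n) > 0"
      using pend[OF t] by blast
    define b where "b = dir_start V Q k / dir_start V P n"
    obtain a c where ac: "c > 0" "zeta V Q k ` (arcset V P n - {V}) =
        (\<lambda>s. a + of_real s * of_real c * b) ` {0..}"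
      unfolding b_def using zeta_arcset[OF P(1-3) V(1,2)] .
    have "c * Re b > 0" "c * (t * Im b) > 0"
      using P(5,6) ac(1) unfolding b_def by (auto intro!: mult_pos_pos)
    then obtain s where s: "s \<ge> 0" "Re a + s * (c * Re b) > M" "t * Im a + s * (c * (t * Im b)) > 0"
      by (rule two_affine_large)
    define u where "u = a + of_real s * of_real c * b"
    have "Re u = Re a + s * (c * Re b)" "t * Im u = t * Im a + s * (c * (t * Im b))"
      by (simp_all add: u_def algebra_simps)
    then have u: "Re u > M" "t * Im u > 0" using s by linarith+
    have "u \<in> zeta V Q k ` (arcset V P n - {V})"
      unfolding ac(2) u_def using s(1) by blast
    then obtain z where z: "z \<in> arcset V P n - {V}" "u = zeta V Q k z" by blast
    have "z = zeta_inv V Q k u"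
      using z zeta_inv_zeta(1)[OF V(1) k0, of z] by simp
    then show "zeta_inv V Q k ` {u. Re u > M \<and> t * Im u > 0} \<inter> X \<noteq> {}"
      using u z(1) P(4) by blast
  qed
  define U where "U = - {V} \<inter> (\<lambda>z. Re (zeta V Q k z)) -` {M<..}"
  have "open U"
    unfolding U_def zeta_def using k0
    by (intro continuous_open_preimage) (auto intro!: continuous_intros)
  \<comment> \<open>A point of the side inside the open set \<open>U\<close>. As \<open>Y\<close>
    accumulates there, some point of \<open>Y\<close> lies in a quarter plane or on the side
    itself.\<close>
  define x where "x = zeta_inv V Q k (of_real (M + 1))"
  have "M \<ge> 0" by (simp add: M_def)
  then have x: "x \<in> arcset V Q k - {V}"
    unfolding arcset_minus_start[OF V(1-3)] x_def by (intro image_eqI[of _ _ "M + 1"]) auto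
  have "x \<in> U"
    using x zeta_zeta_inv(1)[OF V(1) k0 nz[of "of_real (M + 1)"]] by (simp add: U_def x_def)
  moreover have "x \<in> closure Y" using x S Y(1) by auto
  ultimately obtain y where y: "y \<in> U" "y \<in> Y"
    using open_Int_closure_eq_empty[OF \<open>open U\<close>, of Y] by blast
  define u where "u = zeta V Q k y"
  have yu: "y = zeta_inv V Q k u" "Re u > M"
    using y(1) zeta_inv_zeta(1)[OF V(1) k0, of y] by (simp_all add: U_def u_def)
  consider "Im u > 0" | "Im u < 0" | "Im u = 0" by linarith
  then show False
  proof cases
    case 1
    then show False using side[of 1] y yu by auto
  next
    case 2
    then show False using side[of "-1"] y yu by auto
  next
    case 3
    then have "u = of_real (Re u)" by (simp add: complex_eq_iff)
    moreover have "Re u \<ge> 0" using yu(2) \<open>M \<ge> 0\<close> by simp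
    ultimately have "y \<in> arcset V Q k - {V}"
      unfolding arcset_minus_start[OF V(1-3)] yu(1) by (metis atLeast_iff image_eqI)
    then show False using y(2) Y(2) S by auto
  qed
qed

section \<open>Sixth roots of unity and the rotation at a hub\<close>

text \<open>Besides 1 and the primitive roots there remain \<open>-1\<close> and the primitive cube
  roots, with real parts \<open>-1\<close> and \<open>-1/2\<close>.\<close>

lemma Re_inverse_sixth_root_neg:
  fixes j :: complex
  assumes "j ^ 6 = 1" "j \<noteq> 1" "j\<^sup>2 - j + 1 \<noteq> 0"
  shows "Re (1 / j) < 0"
proof -
  have "(j - 1) * (j\<^sup>2 - j + 1) * ((j + 1) * (j\<^sup>2 + j + 1)) = 0"
    using assms(1) by algebra
  then have "j = -1 \<or> j\<^sup>2 + j + 1 = 0" using assms(2,3) by (auto simp: add_eq_0_iff2)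
  then show ?thesis
  proof
    assume h: "j\<^sup>2 + j + 1 = 0"
    then have "(- 1 - j) * j = 1" by algebra
    moreover from this have "j \<noteq> 0" by auto
    ultimately have "1 / j = - 1 - j" by (simp add: nonzero_divide_eq_eq)
    moreover have "norm j ^ 6 = 1" using assms(1) by (simp flip: norm_power)
    then have n: "norm j = 1" using power_eq_imp_eq_base[of "norm j" 6 1] by simp
    then have "1 / j = cnj j" by (simp add: cnj_eq_inverse_unit)
    ultimately have "Re (- 1 - j) = Re (cnj j)" "1 / j = cnj j" by simp_all
    then show ?thesis by simp
  qed simp
qed

lemma sixth_power_root: "e\<^sup>2 - e + 1 = 0 \<Longrightarrow> (e::complex) ^ 6 = 1"
  by algebra

lemma sixth_root_properties:
  assumes "e\<^sup>2 - e + 1 = (0::complex)"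
  shows "Im e \<noteq> 0" "e * (1 - e) = 1"
proof -
  show "e * (1 - e) = 1" using assms by algebra
  show "Im e \<noteq> 0"
  proof
    assume "Im e = 0"
    then have "(Re e)\<^sup>2 - Re e + 1 = 0"
      using assms by (simp add: complex_eq_iff power2_eq_square)
    moreover have "(Re e)\<^sup>2 - Re e + 1 = (Re e - 1/2)\<^sup>2 + 3/4" by (simp add: power2_eq_square algebra_simps)
    ultimately show False using zero_le_power2[of "Re e - 1/2"] by linarith
  qed
qed

text \<open>If the two sides were not neighbours, both neighbours of the first side would be
  pendants in \<open>X\<close> and the second side would point away from it, so \<open>Y\<close>
  could not reach the first side near \<open>V\<close>.\<close>

lemma adjacent_sides_at_vertex:
  assumes V: "V \<noteq> Q" "norm k = 1" "k \<noteq> -1" "V \<noteq> Q'" "norm k' = 1" "k' \<noteq> -1"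
    and R: "closed R" "V \<notin> R"
    and S: "S = arcset V Q k \<union> arcset V Q' k' \<union> R"
    and j: "dir_start V Q' k' = dir_start V Q k * j" "j ^ 6 = 1" "j \<noteq> 1"
    and pend: "\<And>x. x ^ 6 = 1 \<Longrightarrow> x \<noteq> 1 \<Longrightarrow> x \<noteq> j \<Longrightarrow> \<exists>P n. V \<noteq> P \<and> norm n = 1 \<and> n \<noteq> -1 \<and>
        arcset V P n - {V} \<subseteq> X \<and> dir_start V P n = dir_start V Q k * x"
    and comp: "\<And>T. connected T \<Longrightarrow> T \<inter> S = {} \<Longrightarrow> T \<inter> X \<noteq> {} \<Longrightarrow> T \<inter> Y = {}"
    and Y: "S \<subseteq> closure Y" "Y \<inter> S = {}"
  shows "j\<^sup>2 - j + 1 = 0"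
proof (rule ccontr)
  assume nj: "j\<^sup>2 - j + 1 \<noteq> 0"
  have D: "dir_start V Q k \<noteq> 0" using V by (auto simp: dir_start_def sgn_zero_iff)
  show False
  proof (rule curve_on_both_sides_of_arc[OF V R S _ _ comp Y, of X])
    show "Re (dir_start V Q k / dir_start V Q' k') < 0"
      unfolding j(1) using D Re_inverse_sixth_root_neg[OF j(2,3) nj] by simp
    fix t :: real assume t: "t \<in> {1, -1}"
    \<comment> \<open>The sign is reversed because the coordinate inverts directions:
      \<open>1 / x = 1 - x\<close> has imaginary part of sign \<open>t\<close>.\<close>
    define x where "x = Complex (1/2) (- t * sqrt 3 / 2)"
    have x: "x\<^sup>2 - x + 1 = 0" using t by (auto simp: x_def complex_eq_iff power2_eq_square)
    have x1: "x \<noteq> 1" by (simp add: x_def complex_eq_iff)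
    have "x \<noteq> j" using x nj by auto
    then obtain P n where P: "V \<noteq> P" "norm n = 1" "n \<noteq> -1" "arcset V P n - {V} \<subseteq> X"
      "dir_start V P n = dir_start V Q k * x"
      using pend[OF sixth_power_root[OF x] x1] by blast
    have "dir_start V Q k / dir_start V P n = 1 - x"
      unfolding P(5) using D sixth_root_properties(2)[OF x] x x1 by (auto simp: divide_simps mult_ac)
    then have "Re (dir_start V Q k / dir_start V P n) > 0 \<and> t * Im (dir_start V Q k / dir_start V P n) > 0"
      using t by (auto simp: x_def)
    then show "\<exists>P n. V \<noteq> P \<and> norm n = 1 \<and> n \<noteq> -1 \<and> arcset V P n - {V} \<subseteq> X \<and>
        Re (dir_start V Q k / dir_start V P n) > 0 \<and> t * Im (dir_start V Q k / dir_start V P n) > 0"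
      using P by blast
  qed
qed

section \<open>The circle through the hubs and its complement\<close>

text \<open>After multiplication by \<open>e\<close> the pendant is a ray of direction
  \<open>e / e\<^sup>2 = 1 - e\<close>, whose imaginary part is \<open>- Im e\<close>. It enters the
  half plane far out, that is, near \<open>V\<close>.\<close>

lemma pendant_meets_half_plane:
  assumes V: "V \<noteq> Q" "norm k = 1" "V \<noteq> P" "norm n = 1" "n \<noteq> -1"
    and e: "e\<^sup>2 - e + 1 = 0" and d: "dir_start V P n = dir_start V Q k * e\<^sup>2"
  obtains z where "z \<in> arcset V P n - {V}" "Im (e * zeta V Q k z) * Im e < 0"
proof -
  note e' = sixth_root_properties[OF e]
  have D: "dir_start V Q k \<noteq> 0" using V by (auto simp: dir_start_def sgn_zero_iff)
  have e0: "e \<noteq> 0" using e by auto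
  have b: "e * (dir_start V Q k / dir_start V P n) = 1 - e"
    unfolding d using D e0 e'(2) by (simp add: field_simps power2_eq_square)
  obtain a c where ac: "c > 0" "zeta V Q k ` (arcset V P n - {V}) =
      (\<lambda>s. a + of_real s * of_real c * (dir_start V Q k / dir_start V P n)) ` {0..}"
    using zeta_arcset[OF V(3-5) V(1,2)] .
  have "c * (Im e)\<^sup>2 > 0" using e'(1) ac(1) by simp
  then obtain s where s: "s \<ge> 0" "- Im (e * a) * Im e + s * (c * (Im e)\<^sup>2) > 0"
    using two_affine_large[of "c * (Im e)\<^sup>2" "c * (Im e)\<^sup>2"] by metis
  define u where "u = a + of_real s * of_real c * (dir_start V Q k / dir_start V P n)"
  have "e * u = e * a + of_real (s * c) * (e * (dir_start V Q k / dir_start V P n))"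
    by (simp add: u_def distrib_left mult_ac)
  then have "Im (e * u) = Im (e * a) - s * c * Im e" unfolding b by simp
  then have "Im (e * u) * Im e = Im (e * a) * Im e - s * (c * (Im e)\<^sup>2)"
    by (simp only: power2_eq_square left_diff_distrib mult.assoc)
  then have neg: "Im (e * u) * Im e < 0" using s(2) by linarith
  have "u \<in> zeta V Q k ` (arcset V P n - {V})"
    unfolding ac(2) u_def using s(1) by blast
  then obtain z where "z \<in> arcset V P n - {V}" "u = zeta V Q k z" by blast
  then show thesis using that neg by blast
qed

lemma zeta_on_arc:
  assumes "V \<noteq> Q" "norm k = 1" "k \<noteq> -1" "z \<in> arcset V Q k" "z \<noteq> V"
  shows "Im (e * zeta V Q k z) * Im e \<ge> 0"
proof -
  have "k \<noteq> 0" using assms by auto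
  obtain s where s: "s \<ge> 0" "z = zeta_inv V Q k (of_real s)"
    using arcset_minus_start[OF assms(1-3)] assms(4,5) by blast
  have "zeta V Q k z = of_real s"
    unfolding s(2) by (rule zeta_zeta_inv(1)[OF assms(1) \<open>k \<noteq> 0\<close> one_plus_real_mult_unit_nonzero[OF assms(2,3) s(1)]])
  then have "Im (e * zeta V Q k z) * Im e = s * (Im e)\<^sup>2" by (simp add: power2_eq_square)
  then show ?thesis using s(1) by simp
qed

text \<open>\<open>H\<close> is one component of the complement of the circle through the hubs. In
  the coordinate at its own start each side lies in the opposite closed half plane, so
  \<open>H\<close> avoids the triangle, yet pendants at both \<open>A\<close> and \<open>C\<close>
  enter it.\<close>

lemma equal_angles_pendants_same_side:
  assumes dist: "A \<noteq> B" "B \<noteq> C" "C \<noteq> A"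
    and units: "norm k = 1" "k \<noteq> -1" "norm l = 1" "l \<noteq> -1" "norm m = 1" "m \<noteq> -1"
    and e: "e\<^sup>2 - e + 1 = 0"
    and k: "k * sgn (A - C) = - sgn (C - B) * e"
    and l: "l * sgn (B - A) = - sgn (A - C) * e"
    and m: "m * sgn (C - B) = - sgn (B - A) * e"
    and S: "S = arcset A B k \<union> arcset B C l \<union> arcset C A m"
    and P: "A \<noteq> P" "norm n = 1" "n \<noteq> -1" "arcset A P n - {A} \<subseteq> X"
      "dir_start A P n = dir_start A B k * e\<^sup>2"
    and P': "C \<noteq> P'" "norm n' = 1" "n' \<noteq> -1" "arcset C P' n' - {C} \<subseteq> Y"
      "dir_start C P' n' = dir_start C A m * e\<^sup>2"
    and comp: "\<And>T. connected T \<Longrightarrow> T \<inter> S = {} \<Longrightarrow> T \<inter> X \<noteq> {} \<Longrightarrow> T \<inter> Y = {}"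
  shows False
proof -
  have e0: "e \<noteq> 0" using e by auto
  have k0: "k \<noteq> 0" using units by auto
  have sgn_neg: "x * Im e < 0 \<longleftrightarrow> y * Im e < 0" if "sgn x = sgn y" for x y
  proof -
    have "sgn (x * Im e) = sgn (y * Im e)" using that by (simp add: sgn_mult)
    then show ?thesis using sgn_less[of "x * Im e"] sgn_less[of "y * Im e"] by simp
  qed
  \<comment> \<open>The factor \<open>Im e\<close> selects the half plane uniformly for both
    primitive roots \<open>e\<close>.\<close>
  define W where "W = {u. Im (e * u) * Im e < 0}"
  have W: "W = {u. (Im e *\<^sub>R Complex (Im e) (Re e)) \<bullet> u < 0}"
    unfolding W_def by (simp add: inner_complex_def algebra_simps)
  \<comment> \<open>The coordinate of infinity is removed; an open connected subset of the plane
    stays connected without one point.\<close>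
  define H where "H = zeta_inv A B k ` (W - {- 1 / k})"
  have H: "z \<in> H \<longleftrightarrow> z \<noteq> A \<and> Im (e * zeta A B k z) * Im e < 0" for z
  proof
    assume "z \<in> H"
    then obtain u where u: "z = zeta_inv A B k u" "u \<in> W" "u \<noteq> - 1 / k"
      by (auto simp: H_def)
    have "1 + u * k \<noteq> 0" using u(3) k0 by (auto simp: field_simps add_eq_0_iff)
    then show "z \<noteq> A \<and> Im (e * zeta A B k z) * Im e < 0"
      using zeta_zeta_inv[OF dist(1) k0] u by (auto simp: W_def)
  next
    assume z: "z \<noteq> A \<and> Im (e * zeta A B k z) * Im e < 0"
    have "zeta A B k z \<noteq> - 1 / k"
      using zeta_inv_zeta(2)[OF dist(1) k0, of z] z k0 by auto
    then show "z \<in> H"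
      using zeta_inv_zeta(1)[OF dist(1) k0, of z] z unfolding H_def W_def
      by (intro image_eqI[of _ _ "zeta A B k z"]) auto
  qed
  have "connected H"
    unfolding H_def
  proof (rule connected_continuous_image)
    show "continuous_on (W - {- 1 / k}) (zeta_inv A B k)"
      unfolding zeta_inv_def using k0
      by (intro continuous_intros) (auto simp: field_simps add_eq_0_iff)
    have "open W" "convex W"
      unfolding W by (rule open_halfspace_lt, rule convex_halfspace_lt)
    then show "connected (W - {- 1 / k})"
      by (intro connected_open_delete convex_connected) auto
  qed
  moreover have "H \<inter> S = {}"
  proof (rule ccontr)
    assume "\<not> ?thesis"
    then obtain z where z: "z \<noteq> A" "Im (e * zeta A B k z) * Im e < 0" "z \<in> S"
      using H by blast
    have zAB: "z \<notin> arcset A B k"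
    proof
      assume "z \<in> arcset A B k"
      from zeta_on_arc[OF dist(1) units(1,2) this z(1), of e] z(2) show False by linarith
    qed
    then have zB: "z \<noteq> B" by (auto simp: arcset_def)
    have "sgn (Im (e * zeta A B k z)) = sgn (Im (e * zeta B C l z))"
      using Im_zeta_rotate[OF dist(2,3,1) e0 l k zB z(1)] by simp
    then have neg: "Im (e * zeta B C l z) * Im e < 0" using sgn_neg z(2) by blast
    have zBC: "z \<notin> arcset B C l"
    proof
      assume "z \<in> arcset B C l"
      from zeta_on_arc[OF dist(2) units(3,4) this zB, of e] neg show False by linarith
    qed
    then have zC: "z \<noteq> C" by (auto simp: arcset_def)
    have neg: "Im (e * zeta C A m z) * Im e < 0"
      using sgn_neg[OF Im_zeta_rotate[OF dist e0 k m z(1) zC]] z(2) by blast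
    have "z \<notin> arcset C A m"
    proof
      assume "z \<in> arcset C A m"
      from zeta_on_arc[OF dist(3) units(5,6) this zC, of e] neg show False by linarith
    qed
    with zAB zBC z(3) S show False by blast
  qed
  moreover have "H \<inter> X \<noteq> {}"
  proof -
    obtain z where "z \<in> arcset A P n - {A}" "Im (e * zeta A B k z) * Im e < 0"
      using pendant_meets_half_plane[OF dist(1) units(1) P(1-3) e P(5)] .
    then show ?thesis using H P(4) by blast
  qed
  ultimately have "H \<inter> Y = {}" by (rule comp)
  obtain z where z: "z \<in> arcset C P' n' - {C}" "Im (e * zeta C A m z) * Im e < 0"
    using pendant_meets_half_plane[OF dist(3) units(5) P'(1-3) e P'(5)] .
  \<comment> \<open>At \<open>A\<close> the coordinate \<open>zeta C A m\<close> is 0, which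
    violates the strict inequality.\<close>
  have "z \<noteq> A" using z(2) by (auto simp: zeta_def)
  then have "z \<in> H"
    using z H sgn_neg[OF Im_zeta_rotate[OF dist e0 k m, of z]] by blast
  then show False using \<open>H \<inter> Y = {}\<close> z(1) P'(4) by blast
qed

section \<open>The drawing\<close>

lemma curved_triangle_odd_angle:
  fixes A B C k l m j :: complex
  assumes dist: "A \<noteq> B" "B \<noteq> C" "C \<noteq> A"
    and l: "norm l = 1" "l \<noteq> -1"
    and disj: "arcset B C l \<inter> arcset C A m \<subseteq> {C}" "arcset C A m \<inter> arcset A B k \<subseteq> {A}"
    and j: "j\<^sup>2 - j + 1 = 0"
    and eqs: "j * sgn (B - A) = - sgn (A - C) * m * k" "j * sgn (C - B) = - sgn (B - A) * k * l"
      "(1 - j) * sgn (A - C) = - sgn (C - B) * l * m"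
  shows False
proof -
  have nz: "sgn (B - A) \<noteq> 0" "sgn (C - B) \<noteq> 0" "sgn (A - C) \<noteq> 0"
    using dist by (auto simp: sgn_zero_iff)
  have "C \<in> arcset C A m" by (simp add: arcset_def)
  then have "C \<notin> arcset A B k" using disj(2) dist by blast
  then have "k * sgn (A - C) \<noteq> sgn (C - B)"
    using opposite_vertex_on_arc dist by metis
  then obtain e where "e\<^sup>2 - e + 1 = 0" "l * sgn (B - A) = - sgn (A - C) * e\<^sup>2"
    "m * sgn (C - B) = - sgn (B - A) * e\<^sup>2"
    using triangle_angle_odd[OF nz j refl refl eqs] by blast
  then show False
    using arcs_cross[OF dist _ l] disj(1) by blast
qed

text \<open>Each angle is one of two conjugate roots, so if they are not all equal exactly one is
  odd, and a cyclic relabelling reduces to \<open>curved_triangle_odd_angle\<close>. Among equal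
  angles only the root \<open>T = 1\<close> survives.\<close>

lemma curved_triangle_angles:
  fixes A B C k l m ja jb jc :: complex
  assumes dist: "A \<noteq> B" "B \<noteq> C" "C \<noteq> A"
    and units: "norm k = 1" "k \<noteq> -1" "norm l = 1" "l \<noteq> -1" "norm m = 1" "m \<noteq> -1"
    and disj: "arcset A B k \<inter> arcset B C l \<subseteq> {B}" "arcset B C l \<inter> arcset C A m \<subseteq> {C}"
      "arcset C A m \<inter> arcset A B k \<subseteq> {A}"
    and j: "ja\<^sup>2 - ja + 1 = 0" "jb\<^sup>2 - jb + 1 = 0" "jc\<^sup>2 - jc + 1 = 0"
    and eqs: "ja * sgn (B - A) = - sgn (A - C) * m * k" "jb * sgn (C - B) = - sgn (B - A) * k * l"
      "jc * sgn (A - C) = - sgn (C - B) * l * m"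
  shows "jb = ja" "jc = ja" "k * sgn (A - C) = - sgn (C - B) * (1 - ja)"
    "l * sgn (B - A) = - sgn (A - C) * (1 - ja)" "m * sgn (C - B) = - sgn (B - A) * (1 - ja)"
proof -
  have nz: "sgn (B - A) \<noteq> 0" "sgn (C - B) \<noteq> 0" "sgn (A - C) \<noteq> 0"
    using dist by (auto simp: sgn_zero_iff)
  have two: "y = x \<or> y = 1 - x" if "x\<^sup>2 - x + 1 = 0" "y\<^sup>2 - y + 1 = 0" for x y :: complex
  proof -
    have "(y - x) * (y - (1 - x)) = 0" using that by algebra
    then show ?thesis by auto
  qed
  have "\<not> (jb = ja \<and> jc = 1 - ja)"
    using curved_triangle_odd_angle[OF dist units(3,4) disj(2,3) j(1)] eqs by blast
  moreover have "\<not> (jc = jb \<and> ja = 1 - jb)"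
    using curved_triangle_odd_angle[OF dist(2,3,1) units(5,6) disj(3,1) j(2)] eqs by blast
  moreover have "\<not> (ja = jc \<and> jb = 1 - jc)"
    using curved_triangle_odd_angle[OF dist(3,1,2) units(1,2) disj(1,2) j(3)] eqs by blast
  ultimately show j_eq: "jb = ja" "jc = ja"
    using two[OF j(1,2)] two[OF j(1,3)] by auto
  have "\<not> (l * sgn (B - A) = - sgn (A - C) * ja\<^sup>2 \<and> m * sgn (C - B) = - sgn (B - A) * ja\<^sup>2)"
    using arcs_cross[OF dist j(1) units(3,4)] disj(2) by blast
  then show "k * sgn (A - C) = - sgn (C - B) * (1 - ja)"
    "l * sgn (B - A) = - sgn (A - C) * (1 - ja)" "m * sgn (C - B) = - sgn (B - A) * (1 - ja)"
    using triangle_angle_equal[OF nz j(1) eqs(1)] eqs(2,3) unfolding j_eq by blast+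
qed

section \<open>Edge directions at the vertices of a drawing\<close>

text \<open>Divided by any one of them, the directions at a vertex are exactly the roots of unity of
  order \<open>degree E v\<close>.\<close>

lemma lombardi_fan:
  assumes "lombardi_drawing V E pos crv" "v \<in> V" "degree E v > 0"
  shows "f \<in> incident E v \<Longrightarrow> out_dir crv v f \<noteq> 0"
    and "f \<in> incident E v \<Longrightarrow> g \<in> incident E v \<Longrightarrow> (out_dir crv v g / out_dir crv v f) ^ degree E v = 1"
    and "f \<in> incident E v \<Longrightarrow> g \<in> incident E v \<Longrightarrow> f \<noteq> g \<Longrightarrow> out_dir crv v g \<noteq> out_dir crv v f"
    and "f \<in> incident E v \<Longrightarrow> x ^ degree E v = 1 \<Longrightarrow> \<exists>g\<in>incident E v. out_dir crv v g = out_dir crv v f * x"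
proof -
  define n where "n = degree E v"
  obtain w where w: "norm w = 1"
    "bij_betw (out_dir crv v) (incident E v) {w * cis (2 * pi * real k / real n) | k. k < n}"
    using assms unfolding lombardi_drawing_def n_def by blast
  have w0: "w \<noteq> 0" using w(1) by auto
  have "(\<lambda>k. cis (2 * pi * real k / real n)) ` {..<n} = {z. z ^ n = 1}"
    using Complex.bij_betw_roots_unity[of n] assms(3) unfolding n_def bij_betw_def by blast
  moreover have "{w * cis (2 * pi * real k / real n) | k. k < n} =
      (\<lambda>z. w * z) ` (\<lambda>k. cis (2 * pi * real k / real n)) ` {..<n}"
    by blast
  ultimately have img: "out_dir crv v ` incident E v = (\<lambda>z. w * z) ` {z. z ^ n = 1}"
    and inj: "inj_on (out_dir crv v) (incident E v)"
    using w(2) unfolding bij_betw_def by auto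
  have D: "\<exists>z. out_dir crv v f = w * z \<and> z ^ n = 1 \<and> z \<noteq> 0" if "f \<in> incident E v" for f
  proof -
    have "out_dir crv v f \<in> (\<lambda>z. w * z) ` {z. z ^ n = 1}" using that img by blast
    moreover have "z \<noteq> 0" if "z ^ n = 1" for z :: complex
      using that assms(3) unfolding n_def by (metis power_0_left zero_neq_one not_gr_zero)
    ultimately show ?thesis by blast
  qed
  show "f \<in> incident E v \<Longrightarrow> out_dir crv v f \<noteq> 0"
    using D w0 by fastforce
  show "f \<in> incident E v \<Longrightarrow> g \<in> incident E v \<Longrightarrow> (out_dir crv v g / out_dir crv v f) ^ degree E v = 1"
    using D[of f] D[of g] w0 unfolding n_def[symmetric] by (auto simp: power_divide power_mult_distrib)
  show "f \<in> incident E v \<Longrightarrow> g \<in> incident E v \<Longrightarrow> f \<noteq> g \<Longrightarrow> out_dir crv v g \<noteq> out_dir crv v f"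
    using inj by (metis inj_onD)
  show "\<exists>g\<in>incident E v. out_dir crv v g = out_dir crv v f * x"
    if f: "f \<in> incident E v" and x: "x ^ degree E v = 1"
  proof -
    obtain z where z: "out_dir crv v f = w * z" "z ^ n = 1" using D[OF f] by blast
    have "(z * x) ^ n = 1" using z(2) x by (simp add: n_def power_mult_distrib)
    then have "w * (z * x) \<in> out_dir crv v ` incident E v" unfolding img by blast
    then show ?thesis unfolding z(1) by (metis imageE mult.assoc)
  qed
qed

lemma edge_arcset:
  assumes L: "lombardi_drawing V E pos crv" and e: "(u, v) \<in> E" "u \<noteq> v"
  obtains k where "norm k = 1" "k \<noteq> -1" "arc (crv (u, v))" "pos u \<noteq> pos v"
    "path_image (crv (u, v)) = arcset (pos u) (pos v) k"
    "out_dir crv u (u, v) = dir_start (pos u) (pos v) k"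
    "out_dir crv v (u, v) = dir_start (pos v) (pos u) (cnj k)"
proof -
  have *: "circ_arc (crv (u, v))" "pathstart (crv (u, v)) = pos u" "pathfinish (crv (u, v)) = pos v"
    using L e unfolding lombardi_drawing_def by auto
  obtain k where k: "norm k = 1" "k \<noteq> -1" "arc (crv (u, v))"
    "path_image (crv (u, v)) = arcset (pos u) (pos v) k"
    "sgn (vector_derivative (crv (u, v)) (at 0 within {0..1})) = dir_start (pos u) (pos v) k"
    "sgn (- vector_derivative (crv (u, v)) (at 1 within {0..1})) = dir_start (pos v) (pos u) (cnj k)"
    using circ_arc_arcset[OF *(1)] unfolding * by metis
  show thesis
    using that[OF k(1-3) _ k(4)] k(5,6) arc_distinct_ends[OF k(3)] e(2) * by (auto simp: out_dir_def)
qed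

text \<open>Relative to \<open>f\<close> the six directions are the sixth roots of unity. The root 1
  belongs to \<open>f\<close> and \<open>j\<close> to \<open>g\<close>, so every other root is the
  direction of a pendant.\<close>

lemma hub_fan:
  fixes h :: hub
  assumes L: "lombardi_drawing G_V G_E pos crv"
    and inc: "incident G_E (Hub h) = insert f (insert g ((\<lambda>i. (Hub h, Pend h i)) ` {..<4}))"
    and fg: "f \<noteq> g" "f \<notin> (\<lambda>i. (Hub h, Pend h i)) ` {..<4}" "g \<notin> (\<lambda>i. (Hub h, Pend h i)) ` {..<4}"
    and X: "\<forall>i<4. path_image (crv (Hub h, Pend h i)) - {pos (Hub h)} \<subseteq> X"
  obtains j where "out_dir crv (Hub h) g = out_dir crv (Hub h) f * j" "j ^ 6 = 1" "j \<noteq> 1"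
    "\<And>x. x ^ 6 = 1 \<Longrightarrow> x \<noteq> 1 \<Longrightarrow> x \<noteq> j \<Longrightarrow> \<exists>P n. pos (Hub h) \<noteq> P \<and> norm n = 1 \<and> n \<noteq> -1 \<and>
      arcset (pos (Hub h)) P n - {pos (Hub h)} \<subseteq> X \<and>
      dir_start (pos (Hub h)) P n = out_dir crv (Hub h) f * x"
proof
  define O' where "O' = out_dir crv (Hub h)"
  have "card ((\<lambda>i. (Hub h, Pend h i)) ` {..<4::nat}) = 4"
    by (subst card_image) (auto simp: inj_on_def)
  then have deg: "degree G_E (Hub h) = 6"
    unfolding degree_def inc using fg by simp
  have "Hub h \<in> G_V" by (simp add: G_V_def)
  note fan = lombardi_fan[OF L this, unfolded deg, simplified, folded O'_def]
  have inc': "f \<in> incident G_E (Hub h)" "g \<in> incident G_E (Hub h)" using inc by auto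
  note f0 = fan(1)[OF inc'(1)]
  show j: "out_dir crv (Hub h) g = out_dir crv (Hub h) f * (O' g / O' f)"
    using f0 by (simp add: O'_def)
  show "(O' g / O' f) ^ 6 = 1" using fan(2)[OF inc'] .
  show "O' g / O' f \<noteq> 1" using fan(3)[OF inc' fg(1)] f0 by simp
  fix x :: complex assume x: "x ^ 6 = 1" "x \<noteq> 1" "x \<noteq> O' g / O' f"
  obtain q where q: "q \<in> incident G_E (Hub h)" "O' q = O' f * x" using fan(4)[OF inc'(1) x(1)] by blast
  have "q \<noteq> f" "q \<noteq> g" using q(2) x f0 by (auto simp: field_simps)
  then obtain i where i: "q = (Hub h, Pend h i)" "i < 4" using q(1) inc by auto
  then have "(Hub h, Pend h i) \<in> G_E" by (auto simp: G_E_def)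
  then obtain n where n: "norm n = 1" "n \<noteq> -1" "pos (Hub h) \<noteq> pos (Pend h i)"
    "path_image (crv (Hub h, Pend h i)) = arcset (pos (Hub h)) (pos (Pend h i)) n"
    "out_dir crv (Hub h) (Hub h, Pend h i) = dir_start (pos (Hub h)) (pos (Pend h i)) n"
    using edge_arcset[OF L] by (metis vtx.distinct(1))
  show "\<exists>P n. pos (Hub h) \<noteq> P \<and> norm n = 1 \<and> n \<noteq> -1 \<and>
      arcset (pos (Hub h)) P n - {pos (Hub h)} \<subseteq> X \<and>
      dir_start (pos (Hub h)) P n = out_dir crv (Hub h) f * x"
    using n X i q(2) unfolding O'_def by metis
qed

lemma incident_hub:
  "incident G_E (Hub HA) = {(Hub HA, Hub HB), (Hub HC, Hub HA)} \<union> (\<lambda>i. (Hub HA, Pend HA i)) ` {..<4}"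
  "incident G_E (Hub HB) = {(Hub HB, Hub HC), (Hub HA, Hub HB)} \<union> (\<lambda>i. (Hub HB, Pend HB i)) ` {..<4}"
  "incident G_E (Hub HC) = {(Hub HC, Hub HA), (Hub HB, Hub HC)} \<union> (\<lambda>i. (Hub HC, Pend HC i)) ` {..<4}"
  by (auto simp: incident_def G_E_def)

lemma connected_inside_outside_disjoint:
  assumes "connected T" "T \<inter> S = {}" "x \<in> T" "x \<in> inside S" "y \<in> T" "y \<in> outside S"
  shows False
proof -
  have "connected_component (- S) x y"
    unfolding connected_component_def using assms by blast
  then have "y \<in> inside S" using inside_same_component assms(4) by blast
  then show False using assms(6) inside_Int_outside by blast
qed

theorem mainTheorem14:
  shows "\<not> (\<exists>pos crv. lombardi_drawing G_V G_E pos crv \<and> planar_drawing G_E pos crv \<and>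
                     respects_embedding pos crv)"
proof (rule notI, elim exE conjE)
  fix pos crv
  assume L: "lombardi_drawing G_V G_E pos crv" and P: "planar_drawing G_E pos crv"
    and R: "respects_embedding pos crv"
  define A B C where "A = pos (Hub HA)" and "B = pos (Hub HB)" and "C = pos (Hub HC)"
  define S where "S = path_image (triangle_curve crv)"
  have E: "(Hub HA, Hub HB) \<in> G_E" "(Hub HB, Hub HC) \<in> G_E" "(Hub HC, Hub HA) \<in> G_E"
    by (auto simp: G_E_def)
  obtain k where k: "norm k = 1" "k \<noteq> -1" "arc (crv (Hub HA, Hub HB))" "A \<noteq> B"
    "path_image (crv (Hub HA, Hub HB)) = arcset A B k"
    "out_dir crv (Hub HA) (Hub HA, Hub HB) = dir_start A B k"
    "out_dir crv (Hub HB) (Hub HA, Hub HB) = dir_start B A (cnj k)"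
    unfolding A_def B_def using edge_arcset[OF L E(1)] by auto
  obtain l where l: "norm l = 1" "l \<noteq> -1" "arc (crv (Hub HB, Hub HC))" "B \<noteq> C"
    "path_image (crv (Hub HB, Hub HC)) = arcset B C l"
    "out_dir crv (Hub HB) (Hub HB, Hub HC) = dir_start B C l"
    "out_dir crv (Hub HC) (Hub HB, Hub HC) = dir_start C B (cnj l)"
    unfolding B_def C_def using edge_arcset[OF L E(2)] by auto
  obtain m where m: "norm m = 1" "m \<noteq> -1" "arc (crv (Hub HC, Hub HA))" "C \<noteq> A"
    "path_image (crv (Hub HC, Hub HA)) = arcset C A m"
    "out_dir crv (Hub HC) (Hub HC, Hub HA) = dir_start C A m"
    "out_dir crv (Hub HA) (Hub HC, Hub HA) = dir_start A C (cnj m)"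
    unfolding C_def A_def using edge_arcset[OF L E(3)] by auto
  have ends: "pathstart (crv (Hub HA, Hub HB)) = A" "pathfinish (crv (Hub HA, Hub HB)) = B"
    "pathstart (crv (Hub HB, Hub HC)) = B" "pathfinish (crv (Hub HB, Hub HC)) = C"
    "pathstart (crv (Hub HC, Hub HA)) = C" "pathfinish (crv (Hub HC, Hub HA)) = A"
    using L E unfolding lombardi_drawing_def A_def B_def C_def by fastforce+
  have planar: "path_image (crv f) \<inter> path_image (crv g) \<subseteq> pos ` ({fst f, snd f} \<inter> {fst g, snd g})"
    if "f \<in> G_E" "g \<in> G_E" "f \<noteq> g" for f g
    using P that unfolding planar_drawing_def by blast
  have disj: "arcset A B k \<inter> arcset B C l \<subseteq> {B}" "arcset B C l \<inter> arcset C A m \<subseteq> {C}"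
    "arcset C A m \<inter> arcset A B k \<subseteq> {A}"
    using planar[OF E(1,2)] planar[OF E(2,3)] planar[OF E(3,1)]
    by (simp_all add: k(5) l(5) m(5) A_def[symmetric] B_def[symmetric] C_def[symmetric])
  have S: "S = arcset A B k \<union> arcset B C l \<union> arcset C A m"
    unfolding S_def triangle_curve_def using k(5) l(5) m(5) ends by (simp add: path_image_join Un_assoc)
  have "arc (crv (Hub HB, Hub HC) +++ crv (Hub HC, Hub HA))"
    using l(3,5) m(3,5) ends disj(2) by (intro arc_join) auto
  then have "simple_path (triangle_curve crv)"
    unfolding triangle_curve_def using k(3,5) l(5) m(5) ends disj(1,3)
    by (intro simple_path_join_loop) (auto simp: path_image_join)
  moreover have "pathfinish (triangle_curve crv) = pathstart (triangle_curve crv)"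
    unfolding triangle_curve_def using ends by simp
  ultimately have J: "frontier (inside S) = S" "frontier (outside S) = S"
    using Jordan_inside_outside unfolding S_def by blast+
  then have cl: "S \<subseteq> closure (inside S)" "S \<subseteq> closure (outside S)"
    unfolding frontier_def by blast+
  have away: "inside S \<inter> S = {}" "outside S \<inter> S = {}"
    using inside_no_overlap outside_no_overlap by auto
  \<comment> \<open>These two facts serve as the hypothesis \<open>comp\<close>, with the roles of
    inside and outside exchanged.\<close>
  have io: "T \<inter> inside S = {}" if "connected T" "T \<inter> S = {}" "T \<inter> outside S \<noteq> {}" for T
    using connected_inside_outside_disjoint that by blast
  have oi: "T \<inter> outside S = {}" if "connected T" "T \<inter> S = {}" "T \<inter> inside S \<noteq> {}" for T
    using connected_inside_outside_disjoint that by blast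
  have pend: "\<forall>i<4. path_image (crv (Hub HA, Pend HA i)) - {pos (Hub HA)} \<subseteq> outside S"
    "\<forall>i<4. path_image (crv (Hub HB, Pend HB i)) - {pos (Hub HB)} \<subseteq> outside S"
    "\<forall>i<4. path_image (crv (Hub HC, Pend HC i)) - {pos (Hub HC)} \<subseteq> inside S"
    using R unfolding respects_embedding_def S_def by blast+
  have closed: "closed (arcset A B k)" "closed (arcset B C l)" "closed (arcset C A m)"
    using k(3,5) l(3,5) m(3,5) by (metis closed_arc_image)+
  have ABC: "A \<in> arcset A B k" "B \<in> arcset B C l" "C \<in> arcset C A m"
    by (auto simp: arcset_def)
  have opp: "A \<notin> arcset B C l" "B \<notin> arcset C A m" "C \<notin> arcset A B k"
    using disj ABC k(4) l(4) m(4) by blast+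
  have cnj: "norm (cnj k) = 1" "norm (cnj l) = 1" "norm (cnj m) = 1"
    "cnj k \<noteq> -1" "cnj l \<noteq> -1" "cnj m \<noteq> -1"
    using k l m by (auto simp: complex_eq_iff)
  note rev = arcset_reverse[OF k(1,4)] arcset_reverse[OF l(1,4)] arcset_reverse[OF m(1,4)]
  \<comment> \<open>At each hub the outgoing side is the reference, and the incoming side is
    reversed, hence the conjugated half turn.\<close>
  obtain ja where ja: "dir_start A C (cnj m) = dir_start A B k * ja" "ja ^ 6 = 1" "ja \<noteq> 1"
    "\<And>x. x ^ 6 = 1 \<Longrightarrow> x \<noteq> 1 \<Longrightarrow> x \<noteq> ja \<Longrightarrow> \<exists>P n. A \<noteq> P \<and> norm n = 1 \<and> n \<noteq> -1 \<and>
      arcset A P n - {A} \<subseteq> outside S \<and> dir_start A P n = dir_start A B k * x"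
    using hub_fan[OF L _ _ _ _ pend(1), of "(Hub HA, Hub HB)" "(Hub HC, Hub HA)"]
    by (auto simp: incident_hub A_def[symmetric] k(6) m(7) insert_commute)
  obtain jb where jb: "dir_start B A (cnj k) = dir_start B C l * jb" "jb ^ 6 = 1" "jb \<noteq> 1"
    "\<And>x. x ^ 6 = 1 \<Longrightarrow> x \<noteq> 1 \<Longrightarrow> x \<noteq> jb \<Longrightarrow> \<exists>P n. B \<noteq> P \<and> norm n = 1 \<and> n \<noteq> -1 \<and>
      arcset B P n - {B} \<subseteq> outside S \<and> dir_start B P n = dir_start B C l * x"
    using hub_fan[OF L _ _ _ _ pend(2), of "(Hub HB, Hub HC)" "(Hub HA, Hub HB)"]
    by (auto simp: incident_hub B_def[symmetric] l(6) k(7) insert_commute)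
  obtain jc where jc: "dir_start C B (cnj l) = dir_start C A m * jc" "jc ^ 6 = 1" "jc \<noteq> 1"
    "\<And>x. x ^ 6 = 1 \<Longrightarrow> x \<noteq> 1 \<Longrightarrow> x \<noteq> jc \<Longrightarrow> \<exists>P n. C \<noteq> P \<and> norm n = 1 \<and> n \<noteq> -1 \<and>
      arcset C P n - {C} \<subseteq> inside S \<and> dir_start C P n = dir_start C A m * x"
    using hub_fan[OF L _ _ _ _ pend(3), of "(Hub HC, Hub HA)" "(Hub HB, Hub HC)"]
    by (auto simp: incident_hub C_def[symmetric] m(6) l(7) insert_commute)
  have roots: "ja\<^sup>2 - ja + 1 = 0" "jb\<^sup>2 - jb + 1 = 0" "jc\<^sup>2 - jc + 1 = 0"
  proof -
    show "ja\<^sup>2 - ja + 1 = 0"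
      using S rev
      by (intro adjacent_sides_at_vertex[OF k(4,1,2) m(4)[symmetric] cnj(3,6) closed(2) opp(1) _ ja io cl(1) away(1)])
        auto
    show "jb\<^sup>2 - jb + 1 = 0"
      using S rev
      by (intro adjacent_sides_at_vertex[OF l(4,1,2) k(4)[symmetric] cnj(1,4) closed(3) opp(2) _ jb io cl(1) away(1)])
        auto
    \<comment> \<open>At \<open>C\<close> the pendants are inside, so the contradiction concerns the
      accumulation of the outside at the side.\<close>
    show "jc\<^sup>2 - jc + 1 = 0"
      using S rev
      by (intro adjacent_sides_at_vertex[OF m(4,1,2) l(4)[symmetric] cnj(2,5) closed(1) opp(3) _ jc oi cl(2) away(2)])
        auto
  qed
  have sgn_swap: "sgn (x - y) = - sgn (y - x)" for x y :: complex
    by (metis minus_diff_eq sgn_minus)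
  have eqs: "ja * sgn (B - A) = - sgn (A - C) * m * k" "jb * sgn (C - B) = - sgn (B - A) * k * l"
    "jc * sgn (A - C) = - sgn (C - B) * l * m"
    using ja(1) jb(1) jc(1) k(1) l(1) m(1)
    unfolding dir_start_def sgn_swap[of C A] sgn_swap[of A B] sgn_swap[of B C]
    by (auto simp: cnj_eq_inverse_unit field_simps)
  note T = curved_triangle_angles[OF k(4) l(4) m(4) k(1,2) l(1,2) m(1,2) disj roots eqs]
  \<comment> \<open>The pendant at \<open>e\<^sup>2 = - ja\<close> leaves \<open>A\<close> opposite
    to the side towards \<open>C\<close>. Since \<open>jc = ja\<close>, the same root belongs to a
    pendant at \<open>C\<close>.\<close>
  define e where "e = 1 - ja"
  have e: "e\<^sup>2 - e + 1 = 0" "e\<^sup>2 = - ja" using roots(1) unfolding e_def by algebra+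
  have e2: "(e\<^sup>2) ^ 6 = 1" "e\<^sup>2 \<noteq> 1" "e\<^sup>2 \<noteq> ja"
  proof -
    show "(e\<^sup>2) ^ 6 = 1" using e(1) by algebra
    show "e\<^sup>2 \<noteq> ja" using e(2) roots(1) by auto
    show "e\<^sup>2 \<noteq> 1"
    proof
      assume "e\<^sup>2 = 1"
      then have "ja = -1" using e(2) by (metis minus_minus)
      then show False using roots(1) by simp
    qed
  qed
  obtain Q n where Q: "A \<noteq> Q" "norm n = 1" "n \<noteq> -1" "arcset A Q n - {A} \<subseteq> outside S"
    "dir_start A Q n = dir_start A B k * e\<^sup>2"
    using ja(4)[OF e2] by blast
  obtain Q' n' where Q': "C \<noteq> Q'" "norm n' = 1" "n' \<noteq> -1" "arcset C Q' n' - {C} \<subseteq> inside S"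
    "dir_start C Q' n' = dir_start C A m * e\<^sup>2"
    using jc(4)[OF e2(1,2)] e2(3) T(2) by blast
  show False
    using equal_angles_pendants_same_side[OF k(4) l(4) m(4) k(1,2) l(1,2) m(1,2) e(1)
        T(3-5)[folded e_def] S Q Q' io] .
qed

end
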